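(* Let $\bar{\boldsymbol{\mu}}\in\mathbb{R}^d$ and $\boldsymbol{\mu}_{O}\in\mathbb{R}^d$, let $\bar\Sigma,\Sigma_O\in\mathbb{R}^{d\times d}$ and $Q\in\mathbb{R}^{m\times m}$ be symmetric positive definite matrices, let $H\in\mathbb{R}^{m\times d}$, and let $\mathbf{z},\bar{\mathbf{h}}\in\mathbb{R}^m$ (where $\bar{\mathbf h}=h(\bar{\boldsymbol\mu})$). For $\mathbf{x}\in\mathbb{R}^d$ put $$\mathcal{J}(\mathbf{x})=\tfrac12\left(\mathbf{z}-\bar{\mathbf h}-H(\mathbf{x}-\bar{\boldsymbol\mu})\right)^TQ^{-1}\left(\mathbf{z}-\bar{\mathbf h}-H(\mathbf{x}-\bar{\boldsymbol\mu})\right)+\tfrac12(\mathbf{x}-\boldsymbol{\mu}_O)^T\Sigma_O^{-1}(\mathbf{x}-\boldsymbol{\mu}_O)+\tfrac12(\mathbf{x}-\bar{\boldsymbol\mu})^T\bar\Sigma^{-1}(\mathbf{x}-\bar{\boldsymbol\mu}).$$ Then the probability density on $\mathbb{R}^d$ proportional to $\exp(-\mathcal{J}(\mathbf{x}))$ is Gaussian with covariance $\Sigma$ given by $$\Sigma^{-1}=H^TQ^{-1}H+\Sigma_O^{-1}+\bar\Sigma^{-1}$$ and, with $K:=\Sigma H^TQ^{-1}$, mean $$\boldsymbol{\mu}=\bar{\boldsymbol\mu}+K(\mathbf{z}-\bar{\mathbf h})+\Sigma\,\Sigma_O^{-1}(\boldsymbol{\mu}_O-\bar{\boldsymbol\mu}).$$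 Moreover $$\Sigma=(I-KH)\,\bar\Sigma\,(\bar\Sigma+\Sigma_O)^{-1}\,\Sigma_O.$$
   Context: This is the measurement update of an extended Kalman filter that accounts for landmark ("object") uncertainty. The posterior belief of the state $\mathbf{x}$ is proportional to the product of: the measurement likelihood with observation model $\mathbf{z}=h(\mathbf{x})+v$, $v\sim\mathcal{N}(0,Q)$, linearized as $h(\mathbf{x})\approx h(\bar{\boldsymbol\mu})+H(\mathbf{x}-\bar{\boldsymbol\mu})$ with $H$ the Jacobian of $h$; a Gaussian object-uncertainty term $\mathcal{N}(\boldsymbol{\mu}_O,\Sigma_O)$ in $\mathbf{x}$; and the predicted belief $\mathcal{N}(\bar{\boldsymbol\mu},\bar\Sigma)$. The exponent of this product is $-\mathcal{J}$. *)

theory Defs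
  imports "HOL-Probability.Probability"
begin

definition sym_pos_def :: "real ^ 'n ^ 'n \<Rightarrow> bool" where
  "sym_pos_def A \<longleftrightarrow> transpose A = A \<and> (\<forall>x. x \<noteq> 0 \<longrightarrow> 0 < x \<bullet> (A *v x))"

definition mvn_density :: "real ^ 'n \<Rightarrow> real ^ 'n ^ 'n \<Rightarrow> real ^ 'n \<Rightarrow> real" where
  "mvn_density \<mu> \<Sigma> x =
     exp (- ((x - \<mu>) \<bullet> (matrix_inv \<Sigma> *v (x - \<mu>))) / 2) / sqrt ((2 * pi) ^ CARD('n) * det \<Sigma>)"

text \<open>The density proportional to a weight function. It is a probability density only when the
  weight is integrable with positive integral.\<close>

definition normalized :: "(real ^ 'n \<Rightarrow> real) \<Rightarrow> real ^ 'n \<Rightarrow> real" where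
  "normalized f x = f x / (\<integral>y. f y \<partial>lborel)"

definition ekf_cost ::
  "real ^ 'd \<Rightarrow> real ^ 'd ^ 'd \<Rightarrow> real ^ 'd \<Rightarrow> real ^ 'd ^ 'd \<Rightarrow> real ^ 'm ^ 'm \<Rightarrow> real ^ 'd ^ 'm
     \<Rightarrow> real ^ 'm \<Rightarrow> real ^ 'm \<Rightarrow> real ^ 'd \<Rightarrow> real" where
  "ekf_cost \<mu>bar \<Sigma>bar \<mu>O \<Sigma>O Q H z hbar x =
     1/2 * ((z - hbar - H *v (x - \<mu>bar)) \<bullet> (matrix_inv Q *v (z - hbar - H *v (x - \<mu>bar))))
   + 1/2 * ((x - \<mu>O) \<bullet> (matrix_inv \<Sigma>O *v (x - \<mu>O)))
   + 1/2 * ((x - \<mu>bar) \<bullet> (matrix_inv \<Sigma>bar *v (x - \<mu>bar)))"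

end

(*
  Completing the square shows that J is, up to a constant, half the quadratic form of
  L = H^T Q^(-1) H + Sigma_O^(-1) + Sigma_bar^(-1) centred at mu, because L (mu - mu_bar) is the
  linear coefficient H^T Q^(-1) (z - hbar) + Sigma_O^(-1) (mu_O - mu_bar). So exp (- J) is a positive
  multiple of the Gaussian density with covariance S = L^(-1). Gram-Schmidt for the inner product of S
  gives S = A A^T, and the substitution x = mu + A y reduces the moments to those of independent
  standard normal coordinates. Finally I - K H = S (Sigma_O^(-1) + Sigma_bar^(-1)), whose second factor
  is inverse to Sigma_bar (Sigma_bar + Sigma_O)^(-1) Sigma_O.
*)
theory Submission
  imports Defs
begin

section \<open>Linear change of variables\<close>

text \<open>On every line parallel to \<open>u\<close> the coefficient \<open>g\<close> is constant,
  so the shear acts there as a translation, which preserves one-dimensional Lebesgue measure. Fubini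
  with the \<open>u\<close> coordinate innermost then gives the claim.\<close>

lemma nn_integral_lborel_shear:
  fixes f :: "'a::euclidean_space \<Rightarrow> ennreal" and u :: 'a
  assumes [measurable]: "f \<in> borel_measurable borel"
    and u: "u \<in> Basis" and g: "g \<in> borel_measurable borel"
    and g_indep: "\<And>x t. g (x + t *\<^sub>R u) = g x"
  shows "(\<integral>\<^sup>+x. f (x + g x *\<^sub>R u) \<partial>lborel) = (\<integral>\<^sup>+x. f x \<partial>lborel)"
proof -
  interpret product_sigma_finite "\<lambda>_::'a. lborel :: real measure" ..
  note [measurable] = g
  let ?B = "Basis - {u}"
  define s where "s w = (\<Sum>b\<in>?B. w b *\<^sub>R b)" for w :: "'a \<Rightarrow> real"
  have B: "Basis = insert u ?B" "finite ?B" "u \<notin> ?B" using u by auto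
  have sum_upd: "(\<Sum>b\<in>Basis. (w(u := t)) b *\<^sub>R b) = s w + t *\<^sub>R u" for w t
  proof -
    have "(\<Sum>b\<in>Basis. (w(u := t)) b *\<^sub>R b) = t *\<^sub>R u + (\<Sum>b\<in>?B. (w(u := t)) b *\<^sub>R b)"
      by (subst B(1), subst sum.insert) auto
    also have "(\<Sum>b\<in>?B. (w(u := t)) b *\<^sub>R b) = s w"
      unfolding s_def by (intro sum.cong) auto
    finally show ?thesis by simp
  qed
  \<comment> \<open>The coordinates other than \<open>u\<close> are collected in \<open>w\<close>;
    \<open>s w\<close> is the point with these coordinates and \<open>u\<close> coordinate
    0.\<close>
  have fubini: "(\<integral>\<^sup>+x. h x \<partial>lborel) =
      (\<integral>\<^sup>+w. (\<integral>\<^sup>+t. h (s w + t *\<^sub>R u) \<partial>lborel) \<partial>Pi\<^sub>M ?B (\<lambda>_. lborel))"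
    if [measurable]: "h \<in> borel_measurable borel" for h :: "'a \<Rightarrow> ennreal"
  proof -
    have "(\<integral>\<^sup>+x. h x \<partial>lborel) =
        (\<integral>\<^sup>+w. h (\<Sum>b\<in>Basis. w b *\<^sub>R b) \<partial>Pi\<^sub>M (insert u ?B) (\<lambda>_. lborel))"
      by (subst lborel_eq, subst nn_integral_distr) (use B(1) in auto)
    also have "\<dots> = (\<integral>\<^sup>+w. (\<integral>\<^sup>+t. h (\<Sum>b\<in>Basis. (w(u := t)) b *\<^sub>R b) \<partial>lborel)
        \<partial>Pi\<^sub>M ?B (\<lambda>_. lborel))"
      by (subst product_nn_integral_insert[OF B(2,3)]) (use B(1) in auto)
    finally show ?thesis by (simp only: sum_upd)
  qed
  have "(\<integral>\<^sup>+t. f (s w + t *\<^sub>R u + g (s w + t *\<^sub>R u) *\<^sub>R u) \<partial>lborel) =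
      (\<integral>\<^sup>+t. f (s w + t *\<^sub>R u) \<partial>lborel)" for w
    using nn_integral_real_affine[of "\<lambda>t. f (s w + t *\<^sub>R u)" 1 "g (s w)"]
    by (simp add: g_indep algebra_simps)
  then show ?thesis
    by (subst (1 2) fubini) auto
qed

text \<open>The linear change of variables of \<open>HOL-Analysis.Change_Of_Vars\<close> needs a well-ordered index type;
  factoring into elementary matrices works for every finite index type.\<close>

lemma nn_integral_matrix_vector_mult:
  fixes A :: "real ^ 'n ^ 'n" and f :: "real ^ 'n \<Rightarrow> ennreal"
  assumes "invertible A" and "f \<in> borel_measurable borel"
  shows "ennreal \<bar>det A\<bar> * (\<integral>\<^sup>+x. f (A *v x) \<partial>lborel) = (\<integral>\<^sup>+x. f x \<partial>lborel)"
proof -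
  have meas [measurable]: "(\<lambda>x. B *v x) \<in> borel_measurable borel" for B :: "real ^ 'n ^ 'n"
    by (intro borel_measurable_continuous_onI continuous_intros)
  have "\<forall>f \<in> borel_measurable borel. invertible A \<longrightarrow>
      ennreal \<bar>det A\<bar> * (\<integral>\<^sup>+x. f (A *v x) \<partial>lborel) = (\<integral>\<^sup>+x. f x \<partial>lborel)"
  proof (induction A rule: induct_matrix_elementary)
    case (1 A B)
    show ?case
    proof (intro ballI impI)
      fix f :: "real ^ 'n \<Rightarrow> ennreal"
      assume [measurable]: "f \<in> borel_measurable borel" and "invertible (A ** B)"
      then have inv: "invertible A" "invertible B"
        by (auto simp: invertible_det_nz det_mul)
      have "ennreal \<bar>det (A ** B)\<bar> * (\<integral>\<^sup>+x. f ((A ** B) *v x) \<partial>lborel)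
          = ennreal \<bar>det A\<bar> * (ennreal \<bar>det B\<bar> * (\<integral>\<^sup>+x. f (A *v (B *v x)) \<partial>lborel))"
        by (simp add: det_mul abs_mult ennreal_mult mult.assoc matrix_vector_mul_assoc)
      also have "\<dots> = ennreal \<bar>det A\<bar> * (\<integral>\<^sup>+x. f (A *v x) \<partial>lborel)"
        by (subst 1(2)[rule_format, OF _ inv(2)]) auto
      also have "\<dots> = (\<integral>\<^sup>+x. f x \<partial>lborel)"
        by (subst 1(1)[rule_format, OF _ inv(1)]) auto
      finally show "ennreal \<bar>det (A ** B)\<bar> * (\<integral>\<^sup>+x. f ((A ** B) *v x) \<partial>lborel) =
        (\<integral>\<^sup>+x. f x \<partial>lborel)" .
    qed
  next
    \<comment> \<open>A zero row forces determinant 0, which contradicts invertibility.\<close>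
    case (2 A i)
    then show ?case
      by (metis det_zero_row(1) invertible_det_nz row_def)
  next
    case (3 A)
    show ?case
    proof (intro ballI impI)
      fix f :: "real ^ 'n \<Rightarrow> ennreal"
      assume [measurable]: "f \<in> borel_measurable borel" and "invertible A"
      have det: "det A = (\<Prod>i\<in>UNIV. A $ i $ i)"
        using 3 by (intro det_diagonal)
      with \<open>invertible A\<close> have nz: "A $ i $ i \<noteq> 0" for i
        by (auto simp: invertible_det_nz)
      define c where "c b = A $ axis_index b $ axis_index b" for b :: "real ^ 'n"
      have bij: "bij_betw (\<lambda>i. axis i 1) UNIV (Basis :: (real ^ 'n) set)"
        by (auto simp: bij_betw_def inj_on_def axis_eq_axis Basis_vec_def)
      \<comment> \<open>A diagonal matrix scales each basis coordinate separately. The summand 0 is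
        the translation part in the shape that \<open>lborel_affine_euclidean\<close>
        expects.\<close>
      have Ax: "A *v x = 0 + (\<Sum>j\<in>Basis. (c j * (x \<bullet> j)) *\<^sub>R j)" for x
      proof -
        have "(A *v x) $ i = (\<Sum>j\<in>UNIV. if j = i then A $ i $ i * x $ i else 0)" for i
          unfolding matrix_vector_mult_def vec_lambda_beta by (rule sum.cong) (use 3[of i] in auto)
        moreover have "(\<Sum>j\<in>Basis. (c j * (x \<bullet> j)) *\<^sub>R j) = (\<Sum>j\<in>UNIV. (A $ j $ j * x $ j) *\<^sub>R axis j 1)"
          by (simp add: sum.reindex_bij_betw[OF bij, symmetric] c_def axis_index_axis inner_axis)
        ultimately show ?thesis
          by (simp add: vec_eq_iff axis_def if_distrib cong: if_cong)
      qed
      have "c j \<noteq> 0" for j using nz by (simp add: c_def)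
      then have eq: "lborel = density (distr lborel borel (\<lambda>x. A *v x)) (\<lambda>_. \<Prod>j\<in>Basis. ennreal \<bar>c j\<bar>)"
        unfolding Ax using lborel_affine_euclidean[of c 0] by (simp add: prod_ennreal)
      have "(\<Prod>j\<in>Basis. ennreal \<bar>c j\<bar>) = ennreal \<bar>det A\<bar>"
        by (simp add: prod_ennreal det abs_prod c_def prod.reindex_bij_betw[OF bij, symmetric] axis_index_axis)
      then show "ennreal \<bar>det A\<bar> * (\<integral>\<^sup>+x. f (A *v x) \<partial>lborel) = (\<integral>\<^sup>+x. f x \<partial>lborel)"
        by (subst (2) eq) (simp add: nn_integral_density nn_integral_distr nn_integral_cmult)
    qed
  next
    case (4 m n)
    define \<pi> where "\<pi> = Transposition.transpose m n"
    define S :: "real ^ 'n ^ 'n" where "S = (\<chi> i j. mat 1 $ i $ \<pi> j)"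
    have Sx: "(S *v x) $ i = x $ \<pi> i" for x i
    proof -
      have "(S *v x) $ i = (\<Sum>j\<in>UNIV. if j = \<pi> i then x $ j else 0)"
        unfolding matrix_vector_mult_def S_def vec_lambda_beta
        by (rule sum.cong) (auto simp: mat_def \<pi>_def)
      then show ?thesis by simp
    qed
    \<comment> \<open>Swapping two coordinates is an involution, so the square of its determinant is
      1, which fixes the absolute value.\<close>
    have "S ** S = mat 1"
      by (simp add: matrix_eq matrix_vector_mul_assoc[symmetric] vec_eq_iff Sx \<pi>_def)
    then have "det S * det S = 1"
      by (metis det_I det_mul)
    then have det: "\<bar>det S\<bar> = 1"
      by (metis abs_mult_self_eq abs_one abs_square_eq_1 power2_eq_square)
    have bij: "bij_betw (\<lambda>i. axis i 1) UNIV (Basis :: (real ^ 'n) set)"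
      by (auto simp: bij_betw_def inj_on_def axis_eq_axis Basis_vec_def)
    have bij\<pi>: "bij_betw \<pi> UNIV UNIV"
      by (simp add: \<pi>_def)
    have \<pi>\<pi>: "\<pi> (\<pi> i) = i" for i by (simp add: \<pi>_def)
    \<comment> \<open>Lebesgue measure is determined by its values on boxes. The preimage of a box
      under the swap is the box with swapped corners, and its side lengths have the same
      product.\<close>
    have eq: "lborel = distr lborel borel (\<lambda>x. S *v x)"
    proof (rule lborel_eqI)
      fix l u :: "real ^ 'n" assume le: "\<And>b. b \<in> Basis \<Longrightarrow> l \<bullet> b \<le> u \<bullet> b"
      have le': "l $ i \<le> u $ i" for i
        using le[of "axis i 1"] by (simp add: inner_axis)
      have "(\<lambda>x. S *v x) -` box l u = box (S *v l) (S *v u)"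
        by (auto simp: mem_box_cart Sx) (metis \<pi>\<pi>)+
      moreover have "(\<Prod>b\<in>Basis. (S *v u - S *v l) \<bullet> b) = (\<Prod>b\<in>Basis. (u - l) \<bullet> b)"
        using prod.reindex_bij_betw[OF bij\<pi>, of "\<lambda>i. u $ i - l $ i"]
        by (simp add: prod.reindex_bij_betw[OF bij, symmetric] inner_axis Sx)
      ultimately show "emeasure (distr lborel borel (\<lambda>x. S *v x)) (box l u) = (\<Prod>b\<in>Basis. (u - l) \<bullet> b)"
        using le' by (auto simp: emeasure_distr emeasure_lborel_box_eq Basis_vec_def inner_axis Sx)
    qed simp
    have "(\<integral>\<^sup>+x. f (S *v x) \<partial>lborel) = (\<integral>\<^sup>+x. f x \<partial>lborel)"
      if [measurable]: "f \<in> borel_measurable borel" for f :: "real ^ 'n \<Rightarrow> ennreal"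
      using arg_cong[OF eq, of "\<lambda>M. \<integral>\<^sup>+x. f x \<partial>M"] by (simp add: nn_integral_distr)
    then show ?case
      unfolding S_def[unfolded \<pi>_def, symmetric] by (simp add: det)
  next
    case (5 m n c)
    define S :: "real ^ 'n ^ 'n" where "S = (\<chi> i j. if i = m \<and> j = n then c else of_bool (i = j))"
    have Sx: "S *v x = x + (c * x $ n) *\<^sub>R axis m 1" for x
    proof -
      have "(S *v x) $ i = (x + (c * x $ n) *\<^sub>R axis m 1) $ i" for i
      proof -
        have "(S *v x) $ i = (\<Sum>j\<in>UNIV. (if j = i then x $ j else 0) + (if j = n then (if i = m then c * x $ n else 0) else 0))"
          unfolding matrix_vector_mult_def S_def vec_lambda_beta by (rule sum.cong) (use 5 in auto)
        then show ?thesis by (simp add: sum.distrib axis_def)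
      qed
      then show ?thesis by (simp add: vec_eq_iff)
    qed
    have "S = (\<chi> k. if k = m then row m (mat 1) + c *s row n (mat 1) else row k (mat 1))"
      using 5 by (auto simp: S_def vec_eq_iff row_def mat_def)
    then have det: "det S = 1"
      using det_row_operation[OF 5, of "mat 1" c] by simp
    \<comment> \<open>Since \<open>m\<close> and \<open>n\<close> differ, \<open>c * x $ n\<close>
      does not change along \<open>axis m 1\<close>, so this elementary matrix is a shear.\<close>
    have "(\<integral>\<^sup>+x. f (S *v x) \<partial>lborel) = (\<integral>\<^sup>+x. f x \<partial>lborel)"
      if "f \<in> borel_measurable borel" for f :: "real ^ 'n \<Rightarrow> ennreal"
      unfolding Sx using that 5
      by (intro nn_integral_lborel_shear) (auto simp: axis_def Basis_vec_def axis_in_Basis_iff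
          intro!: borel_measurable_continuous_onI continuous_intros)
    then show ?case
      unfolding S_def[symmetric] by (simp add: det)
  qed
  with assms show ?thesis by blast
qed

text \<open>Applied to indicator functions, the nonnegative change of variables identifies
  \<open>lborel\<close> with its own affine image weighted by \<open>\<bar>det A\<bar>\<close>. This
  identity of measures carries the result over to vector-valued Bochner integrals.\<close>

lemma has_bochner_integral_lborel_affine:
  fixes A :: "real ^ 'n ^ 'n" and f :: "real ^ 'n \<Rightarrow> 'b::{banach, second_countable_topology}"
  assumes A: "invertible A" and [measurable]: "f \<in> borel_measurable borel"
    and int: "has_bochner_integral lborel (\<lambda>y. \<bar>det A\<bar> *\<^sub>R f (\<mu> + A *v y)) c"
  shows "has_bochner_integral lborel f c"
proof -
  have [measurable]: "(\<lambda>x. A *v x) \<in> borel_measurable borel"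
    by (intro borel_measurable_continuous_onI continuous_intros)
  have "lborel = density (distr lborel borel (\<lambda>y. \<mu> + A *v y)) (\<lambda>_. ennreal \<bar>det A\<bar>)" (is "_ = ?D")
  proof (rule measure_eqI)
    fix X :: "(real ^ 'n) set" assume "X \<in> sets lborel"
    then have [measurable]: "X \<in> sets borel" by simp
    have "emeasure ?D X = ennreal \<bar>det A\<bar> * (\<integral>\<^sup>+y. indicator X y \<partial>distr lborel borel (\<lambda>y. \<mu> + A *v y))"
      by (simp add: emeasure_density nn_integral_cmult)
    also have "\<dots> = ennreal \<bar>det A\<bar> * (\<integral>\<^sup>+y. indicator X (\<mu> + A *v y) \<partial>lborel)"
      by (subst nn_integral_distr) auto
    also have "\<dots> = (\<integral>\<^sup>+y. indicator X (\<mu> + y) \<partial>lborel)"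
      by (rule nn_integral_matrix_vector_mult[OF A]) simp
    also have "\<dots> = (\<integral>\<^sup>+y. indicator X y \<partial>distr lborel borel ((+) \<mu>))"
      by (subst nn_integral_distr) auto
    finally show "emeasure lborel X = emeasure ?D X"
      by (simp add: lborel_distr_plus)
  qed simp
  moreover have "has_bochner_integral ?D f c"
    using int by (intro has_bochner_integral_density has_bochner_integral_distr) auto
  ultimately show ?thesis by simp
qed

text \<open>Lebesgue measure on \<open>real ^ 'n\<close> is the image of a product measure indexed
  by \<open>Basis\<close>, and \<open>axis i 1\<close> matches that index set with
  \<open>'n\<close>. Independence of the coordinates is thus Fubini for finite products.\<close>

lemma has_bochner_integral_lborel_prod:
  fixes g :: "'n::finite \<Rightarrow> real \<Rightarrow> real"
  assumes g: "\<And>i. has_bochner_integral lborel (g i) (c i)"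
  shows "has_bochner_integral lborel (\<lambda>y::real ^ 'n. \<Prod>i\<in>UNIV. g i (y $ i)) (\<Prod>i\<in>UNIV. c i)"
proof -
  interpret product_sigma_finite "\<lambda>_::real^'n. lborel :: real measure" ..
  have bij: "bij_betw (\<lambda>i. axis i 1) UNIV (Basis :: (real ^ 'n) set)"
    by (auto simp: bij_betw_def inj_on_def axis_eq_axis Basis_vec_def)
  have [measurable]: "g i \<in> borel_measurable borel" for i
    using g[of i] by (auto simp: has_bochner_integral_iff dest: borel_measurable_integrable)
  let ?h = "\<lambda>w. \<Prod>b\<in>Basis. g (axis_index b) (w b)"
  let ?f = "\<lambda>w :: real ^ 'n \<Rightarrow> real. \<Sum>b\<in>Basis. w b *\<^sub>R b"
  have "has_bochner_integral (Pi\<^sub>M (Basis :: (real ^ 'n) set) (\<lambda>_. lborel)) ?h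
      (\<Prod>b\<in>(Basis :: (real ^ 'n) set). c (axis_index b))"
    using g product_integrable_prod[of Basis "\<lambda>b. g (axis_index b)"]
      product_integral_prod[of Basis "\<lambda>b. g (axis_index b)"]
    by (simp add: has_bochner_integral_iff)
  \<comment> \<open>The integrand has to factor through \<open>?f\<close> before it can be moved to
    the image measure.\<close>
  also have "?h = (\<lambda>w. \<Prod>i\<in>UNIV. g i (?f w $ i))"
  proof
    fix w :: "real ^ 'n \<Rightarrow> real"
    have "?f w $ i = w (axis i 1)" for i
      using inner_sum_left_Basis[of "axis i 1" w] by (simp add: inner_axis axis_in_Basis_iff)
    then show "?h w = (\<Prod>i\<in>UNIV. g i (?f w $ i))"
      by (simp add: prod.reindex_bij_betw[OF bij, symmetric] axis_index_axis)
  qed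
  also have "(\<Prod>b\<in>(Basis :: (real ^ 'n) set). c (axis_index b)) = (\<Prod>i\<in>UNIV. c i)"
    by (simp add: prod.reindex_bij_betw[OF bij, symmetric] axis_index_axis)
  finally have "has_bochner_integral (distr (Pi\<^sub>M Basis (\<lambda>_. lborel)) borel ?f)
      (\<lambda>y. \<Prod>i\<in>UNIV. g i (y $ i)) (\<Prod>i\<in>UNIV. c i)"
    by (intro has_bochner_integral_distr) auto
  then show ?thesis by (simp add: lborel_eq[symmetric])
qed

section \<open>Positive definite matrices\<close>

lemma inner_matrix_vector_symmetric:
  fixes A :: "real ^ 'n ^ 'n"
  assumes "transpose A = A"
  shows "x \<bullet> (A *v y) = (A *v x) \<bullet> y"
  by (metis assms dot_lmul_matrix vector_transpose_matrix)

text \<open>For square matrices a right inverse is two-sided, so the choice in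
  \<open>matrix_inv\<close> does yield an inverse, and inverses are unique.\<close>

lemma matrix_inv_eqI:
  fixes A B :: "real ^ 'n ^ 'n"
  assumes "A ** B = mat 1"
  shows "matrix_inv A = B"
proof -
  have "\<exists>B'. A ** B' = mat 1 \<and> B' ** A = mat 1"
    using assms matrix_left_right_inverse by blast
  then have "matrix_inv A ** A = mat 1"
    unfolding matrix_inv_def by (rule someI2_ex) simp
  then show ?thesis
    by (metis assms matrix_mul_assoc matrix_mul_lid matrix_mul_rid)
qed

lemma matrix_inv_right_left:
  fixes A :: "real ^ 'n ^ 'n"
  assumes "invertible A"
  shows "A ** matrix_inv A = mat 1" and "matrix_inv A ** A = mat 1"
  using assms matrix_inv_eqI unfolding invertible_def by metis+

text \<open>A kernel vector has quadratic form 0 and therefore vanishes.\<close>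

lemma sym_pos_def_invertible: "sym_pos_def A \<Longrightarrow> invertible A"
  unfolding sym_pos_def_def invertible_left_inverse matrix_left_invertible_ker
  by (metis inner_zero_right less_irrefl)

lemma transpose_add: "transpose (A + B) = transpose A + transpose (B :: 'a::plus ^ 'n ^ 'm)"
  by (simp add: transpose_def vec_eq_iff)

text \<open>The first summand is only required to be semidefinite, because H^T Q^(-1) H degenerates
  on the kernel of H.\<close>

lemma sym_pos_def_add:
  assumes "transpose A = A" "\<And>x. 0 \<le> x \<bullet> (A *v x)" "sym_pos_def B"
  shows "sym_pos_def (A + B)"
  using assms unfolding sym_pos_def_def
  by (auto simp: transpose_add matrix_vector_mult_add_rdistrib inner_add_right add_nonneg_pos)

lemma sym_pos_def_nonneg: "sym_pos_def A \<Longrightarrow> 0 \<le> x \<bullet> (A *v x)"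
  unfolding sym_pos_def_def by (cases "x = 0") (auto simp: less_imp_le)

text \<open>Writing x = A y turns the quadratic form of the inverse at x into that of A at
  y.\<close>

lemma sym_pos_def_matrix_inv:
  assumes A: "sym_pos_def A"
  shows "sym_pos_def (matrix_inv A)"
proof -
  have inv: "A ** matrix_inv A = mat 1" "matrix_inv A ** A = mat 1"
    using matrix_inv_right_left[OF sym_pos_def_invertible[OF A]] by auto
  have sym: "transpose A = A" using A by (simp add: sym_pos_def_def)
  have "A ** transpose (matrix_inv A) = mat 1"
    by (metis inv(2) matrix_transpose_mul sym transpose_mat)
  then have sym': "transpose (matrix_inv A) = matrix_inv A"
    using matrix_inv_eqI by metis
  have "0 < x \<bullet> (matrix_inv A *v x)" if "x \<noteq> 0" for x
  proof -
    let ?y = "matrix_inv A *v x"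
    have x: "x = A *v ?y" by (simp add: matrix_vector_mul_assoc inv)
    then have "?y \<noteq> 0" using that by auto
    then have "0 < ?y \<bullet> (A *v ?y)" using A by (simp add: sym_pos_def_def)
    then show ?thesis using x by (simp add: inner_commute)
  qed
  with sym' show ?thesis by (simp add: sym_pos_def_def)
qed

text \<open>Gram-Schmidt for the inner product induced by the matrix.\<close>

lemma sym_pos_def_orthonormal_family:
  fixes A :: "real ^ 'n ^ 'n" and S :: "'n set"
  assumes A: "sym_pos_def A"
  shows "\<exists>v. \<forall>i\<in>S. \<forall>j\<in>S. v i \<bullet> (A *v v j) = of_bool (i = j)"
proof -
  have "finite S" by simp
  then show ?thesis
  proof (induction S)
    case (insert k S)
    then obtain v where v: "\<And>i j. i \<in> S \<Longrightarrow> j \<in> S \<Longrightarrow> v i \<bullet> (A *v v j) = of_bool (i = j)"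
      by blast
    \<comment> \<open>The next direction comes from a dimension count: \<open>k\<close> lies outside
      \<open>S\<close>, so the vectors \<open>A *v v i\<close> span a proper subspace and some
      nonzero \<open>x\<close> is orthogonal to all of them. Scaling by \<open>1 / sqrt q\<close>
      then normalizes it.\<close>
    have "dim ((\<lambda>i. A *v v i) ` S) \<le> card S"
      by (rule order_trans[OF dim_le_card' card_image_le]) auto
    also have "\<dots> < DIM(real ^ 'n)"
      using insert.hyps by (simp add: psubset_card_mono psubset_eq) (metis UNIV_I finite psubsetI psubset_card_mono subset_UNIV)
    finally obtain x where "x \<noteq> 0" and "\<forall>y \<in> span ((\<lambda>i. A *v v i) ` S). orthogonal x y"
      by (rule orthogonal_to_subspace_exists) blast
    then have x: "x \<bullet> (A *v v i) = 0" if "i \<in> S" for i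
      using that by (simp add: orthogonal_def span_base)
    have x': "v i \<bullet> (A *v x) = 0" if "i \<in> S" for i
      using x[OF that] A inner_matrix_vector_symmetric[of A "v i" x]
      by (simp add: inner_commute sym_pos_def_def)
    define q where "q = x \<bullet> (A *v x)"
    have "q > 0" using A \<open>x \<noteq> 0\<close> by (simp add: sym_pos_def_def q_def)
    define w where "w = (1 / sqrt q) *\<^sub>R x"
    have "w \<bullet> (A *v w) = 1"
      using \<open>q > 0\<close> by (simp add: w_def matrix_vector_mult_scaleR q_def[symmetric] field_simps)
    then have "\<forall>i\<in>insert k S. \<forall>j\<in>insert k S. (v(k := w)) i \<bullet> (A *v (v(k := w)) j) = of_bool (i = j)"
      using v x x' insert.hyps by (auto simp: w_def matrix_vector_mult_scaleR)
    then show ?case by blast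
  qed simp
qed

text \<open>With a basis orthonormal for S as the rows of V, the Gram matrix V S V^T is the
  identity, so A = V^(-1) is a square root of S in the required sense.\<close>

lemma sym_pos_def_factorization:
  fixes S :: "real ^ 'n ^ 'n"
  assumes S: "sym_pos_def S"
  obtains A :: "real ^ 'n ^ 'n" where "invertible A" and "S = A ** transpose A"
proof -
  obtain v :: "'n \<Rightarrow> real ^ 'n" where v: "\<forall>i j. v i \<bullet> (S *v v j) = of_bool (i = j)"
    using sym_pos_def_orthonormal_family[OF S, of UNIV] by blast
  define V where "V = (\<chi> i. v i)"
  have "(V ** S ** transpose V) $ i $ j = mat 1 $ i $ j" for i j
  proof -
    have "(V ** S ** transpose V) $ i $ j = v i \<bullet> (S *v v j)"
      unfolding matrix_mul_assoc[symmetric]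
      by (simp add: V_def matrix_matrix_mult_def matrix_vector_mult_def transpose_def inner_vec_def)
    then show ?thesis by (simp add: v mat_def)
  qed
  then have VSV: "V ** (S ** transpose V) = mat 1"
    by (simp add: vec_eq_iff matrix_mul_assoc)
  then have V: "invertible V"
    using invertible_right_inverse by blast
  let ?A = "matrix_inv V"
  have A: "V ** ?A = mat 1" "?A ** V = mat 1" using matrix_inv_right_left[OF V] by auto
  then have "transpose V ** transpose ?A = mat 1"
    by (metis matrix_transpose_mul transpose_mat)
  then have "S = ?A ** V ** S ** (transpose V ** transpose ?A)"
    by (simp add: A)
  also have "\<dots> = ?A ** (V ** (S ** transpose V)) ** transpose ?A"
    by (simp only: matrix_mul_assoc)
  also have "\<dots> = ?A ** transpose ?A"
    by (simp add: VSV)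
  finally show thesis
    using that A invertible_def by blast
qed

text \<open>A factorization S = A A^T makes the determinant a nonzero square.\<close>

lemma sym_pos_def_det_pos:
  fixes S :: "real ^ 'n ^ 'n"
  assumes "sym_pos_def S"
  shows "0 < det S"
proof -
  obtain A :: "real ^ 'n ^ 'n" where "invertible A" "S = A ** transpose A"
    using sym_pos_def_factorization[OF assms] .
  then show ?thesis
    by (auto simp: det_mul invertible_det_nz zero_less_mult_iff linorder_neq_iff)
qed

section \<open>Moments of the multivariate normal density\<close>

text \<open>The integral factors over the coordinates, and the standard normal moments of order 0, 1
  and 2 are 1, 0 and 1. A single exponent 1 therefore annihilates the product.\<close>

lemma std_normal_vector_moments:
  fixes e :: "'n::finite \<Rightarrow> nat"
  assumes "\<And>i. e i \<le> 2"
  shows "has_bochner_integral lborel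
    (\<lambda>y::real ^ 'n. (\<Prod>i\<in>UNIV. std_normal_density (y $ i)) * (\<Prod>i\<in>UNIV. (y $ i) ^ e i))
    (of_bool (\<forall>i. e i \<noteq> 1))"
proof -
  have "has_bochner_integral lborel (\<lambda>t. std_normal_density t * t ^ e i) (of_bool (e i \<noteq> 1))" for i
  proof -
    consider "e i = 0" | "e i = 1" | "e i = 2" using assms[of i] by linarith
    then show ?thesis
      using std_normal_moment_even[of 0] std_normal_moment_even[of 1] std_normal_moment_odd[of 0]
      by cases (auto simp: fact_numeral)
  qed
  note has_bochner_integral_lborel_prod[of "\<lambda>i t. std_normal_density t * t ^ e i", OF this]
  moreover have "(\<Prod>i\<in>UNIV. of_bool (e i \<noteq> 1) :: real) = of_bool (\<forall>i. e i \<noteq> 1)"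
    by (auto simp: of_bool_def)
  ultimately show ?thesis by (simp add: prod.distrib)
qed

text \<open>Under x = \<mu> + A y the Gaussian becomes standard: its quadratic form turns into the
  squared norm of y, and the Jacobian \<open>\<bar>det A\<bar>\<close> cancels the square root of
  det S in the normalization.\<close>

lemma has_bochner_integral_mvn_density:
  fixes A S :: "real ^ 'n ^ 'n" and f :: "real ^ 'n \<Rightarrow> 'b::{banach, second_countable_topology}"
  assumes A: "invertible A" and S: "S = A ** transpose A" and f: "f \<in> borel_measurable borel"
    and int: "has_bochner_integral lborel
      (\<lambda>y. (\<Prod>i\<in>UNIV. std_normal_density (y $ i)) *\<^sub>R f (\<mu> + A *v y)) c"
  shows "has_bochner_integral lborel (\<lambda>x. mvn_density \<mu> S x *\<^sub>R f x) c"
proof -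
  have mv [measurable]: "(\<lambda>x. B *v x) \<in> borel_measurable borel" for B :: "real ^ 'n ^ 'n"
    by (intro borel_measurable_continuous_onI continuous_intros)
  note [measurable] = f
  let ?B = "matrix_inv A"
  have B: "A ** ?B = mat 1" "?B ** A = mat 1" using matrix_inv_right_left[OF A] by auto
  have B': "transpose A ** transpose ?B = mat 1"
    using B by (metis matrix_transpose_mul transpose_mat)
  have "S ** (transpose ?B ** ?B) = A ** (transpose A ** transpose ?B) ** ?B"
    by (simp only: S matrix_mul_assoc)
  also have "\<dots> = mat 1" by (simp add: B B')
  finally have inv: "matrix_inv S = transpose ?B ** ?B"
    by (rule matrix_inv_eqI)
  \<comment> \<open>With B = A^(-1), the inverse of S is B^T B, so the form at A y is the squared
    norm of B A y = y.\<close>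
  have quad: "(A *v y) \<bullet> (matrix_inv S *v (A *v y)) = (\<Sum>i\<in>UNIV. (y $ i)\<^sup>2)" for y
  proof -
    have "matrix_inv S *v (A *v y) = transpose ?B *v y"
      by (simp add: inv matrix_vector_mul_assoc matrix_mul_assoc[symmetric] B)
    then have "(A *v y) \<bullet> (matrix_inv S *v (A *v y)) = (?B *v (A *v y)) \<bullet> y"
      by (metis dot_lmul_matrix transpose_transpose vector_transpose_matrix)
    then show ?thesis
      by (simp add: matrix_vector_mul_assoc B inner_vec_def power2_eq_square)
  qed
  have det: "sqrt ((2 * pi) ^ CARD('n) * det S) = sqrt (2 * pi) ^ CARD('n) * \<bar>det A\<bar>"
    by (simp add: S det_mul real_sqrt_mult real_sqrt_power power_mult_distrib)
  have "\<bar>det A\<bar> \<noteq> 0" using A by (simp add: invertible_det_nz)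
  then have "\<bar>det A\<bar> * mvn_density \<mu> S (\<mu> + A *v y) = (\<Prod>i\<in>UNIV. std_normal_density (y $ i))" for y
    unfolding mvn_density_def det
    by (simp add: quad std_normal_density_def prod_dividef exp_sum[symmetric] sum_negf sum_divide_distrib)
  then have "has_bochner_integral lborel
      (\<lambda>y. \<bar>det A\<bar> *\<^sub>R (mvn_density \<mu> S (\<mu> + A *v y) *\<^sub>R f (\<mu> + A *v y))) c"
    using int by simp
  then show ?thesis
    by (rule has_bochner_integral_lborel_affine[OF A, rotated]) (simp add: mvn_density_def[abs_def])
qed

lemma mvn_density_moments:
  fixes S :: "real ^ 'n ^ 'n" and \<mu> :: "real ^ 'n"
  assumes S: "sym_pos_def S"
  shows has_bochner_integral_mvn_density_total: "has_bochner_integral lborel (mvn_density \<mu> S) 1"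
    and has_bochner_integral_mvn_density_mean:
      "has_bochner_integral lborel (\<lambda>x. mvn_density \<mu> S x *\<^sub>R x) \<mu>"
    and has_bochner_integral_mvn_density_covariance:
      "has_bochner_integral lborel (\<lambda>x. mvn_density \<mu> S x *\<^sub>R ((x - \<mu>) $ i * (x - \<mu>) $ j)) (S $ i $ j)"
proof -
  obtain A :: "real ^ 'n ^ 'n" where A: "invertible A" and SA: "S = A ** transpose A"
    using sym_pos_def_factorization[OF S] .
  note transfer = has_bochner_integral_mvn_density[OF A SA]
  let ?\<phi> = "\<lambda>y :: real ^ 'n. \<Prod>i\<in>UNIV. std_normal_density (y $ i)"
  have m0: "has_bochner_integral lborel ?\<phi> 1"
    using std_normal_vector_moments[of "\<lambda>_::'n. 0"] by simp
  have m1: "has_bochner_integral lborel (\<lambda>y. ?\<phi> y * y $ k) 0" for k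
  proof -
    \<comment> \<open>A single coordinate is the monomial whose exponents are the indicator of
      \<open>k\<close>.\<close>
    have "(\<Prod>i\<in>UNIV. (y $ i) ^ of_bool (i = k)) = y $ k" for y :: "real ^ 'n"
      by (simp add: of_bool_def if_distrib cong: if_cong)
    moreover have "has_bochner_integral lborel
        (\<lambda>y. ?\<phi> y * (\<Prod>i\<in>UNIV. (y $ i) ^ of_bool (i = k))) (of_bool (\<forall>i. of_bool (i = k) \<noteq> (1::nat)))"
      by (rule std_normal_vector_moments) (simp add: of_bool_def)
    moreover have "(\<forall>i. of_bool (i = k) \<noteq> (1::nat)) \<longleftrightarrow> False"
      by auto
    ultimately show ?thesis
      by (simp only: of_bool_eq)
  qed
  have m2: "has_bochner_integral lborel (\<lambda>y. ?\<phi> y * (y $ k * y $ l)) (of_bool (k = l))" for k l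
  proof -
    \<comment> \<open>The sum of the two indicators avoids the value 1 exactly when
      \<open>k = l\<close>; this gives the identity covariance.\<close>
    have "(\<Prod>i\<in>UNIV. (y $ i) ^ (of_bool (i = k) + of_bool (i = l))) = y $ k * y $ l" for y :: "real ^ 'n"
      by (simp add: power_add prod.distrib) (simp add: of_bool_def if_distrib cong: if_cong)
    moreover have "(\<forall>i. of_bool (i = k) + of_bool (i = l) \<noteq> (1::nat)) \<longleftrightarrow> k = l"
      by (auto simp: of_bool_def)
    moreover have "of_bool (i = k) + of_bool (i = l) \<le> (2::nat)" for i
      by (simp add: of_bool_def)
    ultimately show ?thesis
      using std_normal_vector_moments[of "\<lambda>i. of_bool (i = k) + of_bool (i = l)"]
      by simp
  qed
  show "has_bochner_integral lborel (mvn_density \<mu> S) 1"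
    using transfer[of "\<lambda>_. 1::real" \<mu> 1] m0 by simp
  \<comment> \<open>Expanding \<open>A *v y\<close> in the columns of \<open>A\<close> reduces the
    vector-valued mean to the scalar first moments, which vanish.\<close>
  have "has_bochner_integral lborel (\<lambda>y. ?\<phi> y *\<^sub>R \<mu> + (\<Sum>k\<in>UNIV. (?\<phi> y * y $ k) *\<^sub>R column k A))
      (1 *\<^sub>R \<mu> + (\<Sum>k\<in>UNIV. 0 *\<^sub>R column k A))"
    using m0 m1 by (intro has_bochner_integral_add has_bochner_integral_sum
        has_bochner_integral_scaleR_left) auto
  also have "(\<lambda>y. ?\<phi> y *\<^sub>R \<mu> + (\<Sum>k\<in>UNIV. (?\<phi> y * y $ k) *\<^sub>R column k A)) = (\<lambda>y. ?\<phi> y *\<^sub>R (\<mu> + A *v y))"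
    by (simp add: fun_eq_iff matrix_mult_sum scalar_mult_eq_scaleR scaleR_add_right scaleR_sum_right)
  finally show "has_bochner_integral lborel (\<lambda>x. mvn_density \<mu> S x *\<^sub>R x) \<mu>"
    by (intro transfer) auto
  \<comment> \<open>Expanding both coordinates of \<open>A *v y\<close> gives a double sum of second
    moments; only its diagonal survives and equals the (i, j) entry of A A^T.\<close>
  have "has_bochner_integral lborel
      (\<lambda>y. \<Sum>k\<in>UNIV. \<Sum>l\<in>UNIV. (?\<phi> y * (y $ k * y $ l)) * (A $ i $ k * A $ j $ l))
      (\<Sum>k\<in>UNIV. \<Sum>l\<in>UNIV. of_bool (k = l) * (A $ i $ k * A $ j $ l))"
    using m2 by (intro has_bochner_integral_sum has_bochner_integral_mult_left) auto
  also have "(\<lambda>y. \<Sum>k\<in>UNIV. \<Sum>l\<in>UNIV. (?\<phi> y * (y $ k * y $ l)) * (A $ i $ k * A $ j $ l)) =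
      (\<lambda>y. ?\<phi> y *\<^sub>R ((\<mu> + A *v y - \<mu>) $ i * (\<mu> + A *v y - \<mu>) $ j))"
  proof
    fix y
    have "(A *v y) $ i * (A *v y) $ j = (\<Sum>k\<in>UNIV. \<Sum>l\<in>UNIV. (A $ i $ k * y $ k) * (A $ j $ l * y $ l))"
      by (simp only: matrix_vector_mult_def vec_lambda_beta sum_product)
    then show "(\<Sum>k\<in>UNIV. \<Sum>l\<in>UNIV. (?\<phi> y * (y $ k * y $ l)) * (A $ i $ k * A $ j $ l)) =
        ?\<phi> y *\<^sub>R ((\<mu> + A *v y - \<mu>) $ i * (\<mu> + A *v y - \<mu>) $ j)"
      by (simp add: sum_distrib_left mult_ac)
  qed
  also have "(\<Sum>k\<in>UNIV. \<Sum>l\<in>UNIV. of_bool (k = l) * (A $ i $ k * A $ j $ l)) = S $ i $ j"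
    by (simp add: SA matrix_matrix_mult_def transpose_def of_bool_def if_distrib[of "\<lambda>c. c * _"] cong: if_cong)
  finally show "has_bochner_integral lborel
      (\<lambda>x. mvn_density \<mu> S x *\<^sub>R ((x - \<mu>) $ i * (x - \<mu>) $ j)) (S $ i $ j)"
    by (intro transfer) auto
qed

section \<open>The measurement update\<close>

lemma complete_square:
  fixes L :: "real ^ 'n ^ 'n"
  assumes "transpose L = L"
  shows "(x - m) \<bullet> (L *v (x - m)) = x \<bullet> (L *v x) - 2 * (x \<bullet> (L *v m)) + m \<bullet> (L *v m)"
  using inner_matrix_vector_symmetric[OF assms, of m x]
  by (simp add: matrix_vector_mult_diff_distrib inner_diff_left inner_diff_right inner_commute)

lemma inner_transpose_mult:
  "(x :: real ^ 'n) \<bullet> (transpose H *v y) = (H *v x) \<bullet> (y :: real ^ 'm)"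
  using dot_lmul_matrix[of x "transpose H" y] by (simp del: transpose_matrix_vector)

text \<open>The hypothesis on \<open>m\<close> is the stationarity condition of the cost at \<mu>bar
  + m. It makes the linear terms of both sides agree, while the quadratic terms agree by the choice
  of \<open>L\<close>.\<close>

lemma ekf_cost_eq:
  fixes H :: "real ^ 'd ^ 'm"
  assumes sym: "sym_pos_def \<Sigma>bar" "sym_pos_def \<Sigma>O" "sym_pos_def Q"
  defines "L \<equiv> transpose H ** matrix_inv Q ** H + matrix_inv \<Sigma>O + matrix_inv \<Sigma>bar"
  assumes m: "L *v m = transpose H *v (matrix_inv Q *v (z - hbar)) + matrix_inv \<Sigma>O *v (\<mu>O - \<mu>bar)"
  obtains c where "\<And>x. ekf_cost \<mu>bar \<Sigma>bar \<mu>O \<Sigma>O Q H z hbar x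
    = ((x - (\<mu>bar + m)) \<bullet> (L *v (x - (\<mu>bar + m)))) / 2 + c"
proof -
  have t: "transpose (matrix_inv Q) = matrix_inv Q" "transpose (matrix_inv \<Sigma>O) = matrix_inv \<Sigma>O"
      "transpose (matrix_inv \<Sigma>bar) = matrix_inv \<Sigma>bar"
    using sym sym_pos_def_matrix_inv sym_pos_def_def by blast+
  have tL: "transpose L = L"
    by (simp add: L_def transpose_add t matrix_transpose_mul matrix_mul_assoc)
  let ?r = "z - hbar" and ?a = "\<mu>O - \<mu>bar"
  \<comment> \<open>These are the terms free of \<open>x\<close>: the constants of the measurement
    and object terms, minus the one that the square centred at \<open>m\<close> introduces.\<close>
  let ?c = "(?r \<bullet> (matrix_inv Q *v ?r) + ?a \<bullet> (matrix_inv \<Sigma>O *v ?a) - m \<bullet> (L *v m)) / 2"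
  have "ekf_cost \<mu>bar \<Sigma>bar \<mu>O \<Sigma>O Q H z hbar x
    = ((x - (\<mu>bar + m)) \<bullet> (L *v (x - (\<mu>bar + m)))) / 2 + ?c" for x
  proof -
    \<comment> \<open>Measured from \<mu>bar, the prior term is purely quadratic and contributes
      neither a linear nor a constant term.\<close>
    define y where "y = x - \<mu>bar"
    have xs: "x - (\<mu>bar + m) = y - m" "x - \<mu>O = y - ?a" "x - \<mu>bar = y"
      by (simp_all add: y_def)
    have "(?r - H *v y) \<bullet> (matrix_inv Q *v (?r - H *v y)) = (H *v y - ?r) \<bullet> (matrix_inv Q *v (H *v y - ?r))"
      by (simp add: matrix_vector_mult_diff_distrib inner_diff_left inner_diff_right)
    also have "\<dots> = (H *v y) \<bullet> (matrix_inv Q *v (H *v y)) - 2 * ((H *v y) \<bullet> (matrix_inv Q *v ?r))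
       + ?r \<bullet> (matrix_inv Q *v ?r)"
      by (rule complete_square[OF t(1)])
    finally have q: "(?r - H *v y) \<bullet> (matrix_inv Q *v (?r - H *v y)) = \<dots>" .
    have "y \<bullet> (L *v y) = (H *v y) \<bullet> (matrix_inv Q *v (H *v y)) + y \<bullet> (matrix_inv \<Sigma>O *v y)
        + y \<bullet> (matrix_inv \<Sigma>bar *v y)"
      by (simp add: L_def matrix_vector_mult_add_rdistrib inner_add_right inner_transpose_mult
          matrix_vector_mul_assoc[symmetric] del: transpose_matrix_vector)
    moreover have "y \<bullet> (L *v m) = (H *v y) \<bullet> (matrix_inv Q *v ?r) + y \<bullet> (matrix_inv \<Sigma>O *v ?a)"
      by (simp add: m inner_add_right inner_transpose_mult del: transpose_matrix_vector)
    ultimately show ?thesis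
      unfolding ekf_cost_def xs q complete_square[OF t(2)] complete_square[OF tL]
      by (simp add: field_simps)
  qed
  then show thesis by (rule that)
qed

lemma matrix_add_rdistrib: "(A + B) ** C = A ** C + B ** (C :: 'a::semiring_1 ^ 'p ^ 'n)"
  by (vector matrix_matrix_mult_def sum.distrib[symmetric] field_simps)

text \<open>The identity B^(-1) + A^(-1) = B^(-1) (A + B) A^(-1) makes the product telescope. The
  second factor is the parallel sum of A and B.\<close>

lemma parallel_sum_inverse:
  fixes A B :: "real ^ 'n ^ 'n"
  assumes "sym_pos_def A" "sym_pos_def B"
  shows "(matrix_inv B + matrix_inv A) ** (A ** matrix_inv (A + B) ** B) = mat 1"
proof -
  have "sym_pos_def (A + B)"
    using assms sym_pos_def_nonneg by (intro sym_pos_def_add) (auto simp: sym_pos_def_def)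
  note inv = this[THEN sym_pos_def_invertible, THEN matrix_inv_right_left(1)]
    assms[THEN sym_pos_def_invertible, THEN matrix_inv_right_left(2)]
    assms[THEN sym_pos_def_invertible, THEN matrix_inv_right_left(1)]
  have "matrix_inv B + matrix_inv A = matrix_inv B ** (A + B) ** matrix_inv A"
    by (simp add: matrix_add_ldistrib matrix_add_rdistrib matrix_mul_assoc[symmetric] inv)
  then have "(matrix_inv B + matrix_inv A) ** (A ** matrix_inv (A + B) ** B)
      = matrix_inv B ** ((A + B) ** (matrix_inv A ** A) ** matrix_inv (A + B)) ** B"
    by (simp only: matrix_mul_assoc)
  then show ?thesis by (simp add: inv)
qed

text \<open>Integrability and positivity make \<open>normalized\<close> a genuine normalization. The
  moment clauses tie \<mu> and \<Sigma> to the measure \<open>P\<close> itself, beyond their role as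
  parameters of the formula \<open>mvn_density\<close>.\<close>

theorem mainTheorem2:
  fixes \<mu>bar \<mu>O :: "real ^ 'd"
    and \<Sigma>bar \<Sigma>O :: "real ^ 'd ^ 'd"
    and Q :: "real ^ 'm ^ 'm"
    and H :: "real ^ 'd ^ 'm"
    and z hbar :: "real ^ 'm"
  assumes "sym_pos_def \<Sigma>bar" and "sym_pos_def \<Sigma>O" and "sym_pos_def Q"
  shows
    "let J = ekf_cost \<mu>bar \<Sigma>bar \<mu>O \<Sigma>O Q H z hbar;
         p = normalized (\<lambda>x. exp (- J x));
         P = density lborel (\<lambda>x. ennreal (p x));
         \<Sigma> = matrix_inv (transpose H ** matrix_inv Q ** H + matrix_inv \<Sigma>O + matrix_inv \<Sigma>bar);
         K = \<Sigma> ** transpose H ** matrix_inv Q;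
         \<mu> = \<mu>bar + K *v (z - hbar) + (\<Sigma> ** matrix_inv \<Sigma>O) *v (\<mu>O - \<mu>bar)
     in integrable lborel (\<lambda>x. exp (- J x))
        \<and> 0 < (\<integral>x. exp (- J x) \<partial>lborel)
        \<and> prob_space P
        \<and> sym_pos_def \<Sigma>
        \<and> matrix_inv \<Sigma> = transpose H ** matrix_inv Q ** H + matrix_inv \<Sigma>O + matrix_inv \<Sigma>bar
        \<and> (\<forall>x. p x = mvn_density \<mu> \<Sigma> x)
        \<and> has_bochner_integral P (\<lambda>x. x) \<mu>
        \<and> (\<forall>i j. has_bochner_integral P (\<lambda>x. (x - \<mu>) $ i * (x - \<mu>) $ j) (\<Sigma> $ i $ j))
        \<and> \<Sigma> = (mat 1 - K ** H) ** \<Sigma>bar ** matrix_inv (\<Sigma>bar + \<Sigma>O) ** \<Sigma>O"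
proof -
  define J where "J = ekf_cost \<mu>bar \<Sigma>bar \<mu>O \<Sigma>O Q H z hbar"
  define p where "p = normalized (\<lambda>x. exp (- J x))"
  define P where "P = density lborel (\<lambda>x. ennreal (p x))"
  define L where "L = transpose H ** matrix_inv Q ** H + matrix_inv \<Sigma>O + matrix_inv \<Sigma>bar"
  define S where "S = matrix_inv L"
  define K where "K = S ** transpose H ** matrix_inv Q"
  define m where "m = K *v (z - hbar) + (S ** matrix_inv \<Sigma>O) *v (\<mu>O - \<mu>bar)"
  define \<mu> where "\<mu> = \<mu>bar + K *v (z - hbar) + (S ** matrix_inv \<Sigma>O) *v (\<mu>O - \<mu>bar)"
  have \<mu>m: "\<mu> = \<mu>bar + m" by (simp add: \<mu>_def m_def)
  have spd: "sym_pos_def (matrix_inv Q)" "sym_pos_def (matrix_inv \<Sigma>O)" "sym_pos_def (matrix_inv \<Sigma>bar)"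
    using assms sym_pos_def_matrix_inv by auto
  \<comment> \<open>The measurement information is symmetric and semidefinite, its form at x being
    that of Q^(-1) at H x. Definiteness of \<open>L\<close> comes from the two other
    summands.\<close>
  have "transpose (transpose H ** matrix_inv Q ** H) = transpose H ** matrix_inv Q ** H"
    using spd(1) by (simp add: matrix_transpose_mul matrix_mul_assoc sym_pos_def_def)
  moreover have "0 \<le> x \<bullet> ((transpose H ** matrix_inv Q ** H) *v x)" for x
    using sym_pos_def_nonneg[OF spd(1), of "H *v x"]
    by (simp add: inner_transpose_mult matrix_vector_mul_assoc[symmetric] del: transpose_matrix_vector)
  ultimately have spdL: "sym_pos_def L"
    unfolding L_def add.assoc using spd sym_pos_def_nonneg
    by (intro sym_pos_def_add) (auto simp: sym_pos_def_def)
  then have spdS: "sym_pos_def S" unfolding S_def by (rule sym_pos_def_matrix_inv)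
  have LS: "L ** S = mat 1" "S ** L = mat 1"
    unfolding S_def using matrix_inv_right_left[OF sym_pos_def_invertible[OF spdL]] by auto
  then have Sinv: "matrix_inv S = L" by (intro matrix_inv_eqI)

  \<comment> \<open>Factoring \<open>S\<close> out of both gain terms shows that \<open>m\<close> is
    \<open>S\<close> applied to the linear coefficient of the cost, as \<open>ekf_cost_eq\<close>
    requires.\<close>
  have "L *v m = (L ** S) *v (transpose H *v (matrix_inv Q *v (z - hbar)) + matrix_inv \<Sigma>O *v (\<mu>O - \<mu>bar))"
    by (simp add: m_def K_def matrix_vector_right_distrib matrix_vector_mul_assoc matrix_mul_assoc
        del: transpose_matrix_vector)
  then have "L *v m = transpose H *v (matrix_inv Q *v (z - hbar)) + matrix_inv \<Sigma>O *v (\<mu>O - \<mu>bar)"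
    by (simp add: LS)
  then obtain c where c: "\<And>x. J x = ((x - \<mu>) \<bullet> (L *v (x - \<mu>))) / 2 + c"
    using ekf_cost_eq[OF assms, of H m z hbar \<mu>O \<mu>bar] unfolding L_def J_def \<mu>m by blast
  \<comment> \<open>This is the normalizing integral of exp (- J): the minimum cost contributes exp
    (- c), the Gaussian its usual constant.\<close>
  define C where "C = exp (- c) * sqrt ((2 * pi) ^ CARD('d) * det S)"
  have "C > 0" using sym_pos_def_det_pos[OF spdS] by (simp add: C_def)
  have expJ: "exp (- J x) = C * mvn_density \<mu> S x" for x
    using sym_pos_def_det_pos[OF spdS] by (simp add: C_def mvn_density_def Sinv c exp_add[symmetric])
  have int: "has_bochner_integral lborel (\<lambda>x. exp (- J x)) C"
    unfolding expJ using has_bochner_integral_mult_right[OF has_bochner_integral_mvn_density_total[OF spdS], of C \<mu>]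
    by simp
  then have intJ: "integrable lborel (\<lambda>x. exp (- J x))" "(\<integral>x. exp (- J x) \<partial>lborel) = C"
    by (auto simp: has_bochner_integral_iff)
  have p: "p x = mvn_density \<mu> S x" for x
    using \<open>C > 0\<close> by (simp add: p_def normalized_def intJ(2)) (simp add: expJ)
  have p_nonneg: "0 \<le> p x" for x
    using \<open>C > 0\<close> by (simp add: p_def normalized_def intJ(2))
  have p_int: "has_bochner_integral lborel p 1"
    using has_bochner_integral_mvn_density_total[OF spdS, of \<mu>] by (simp add: p[symmetric, abs_def])
  then have [measurable]: "p \<in> borel_measurable borel"
    by (auto simp: has_bochner_integral_iff dest: borel_measurable_integrable)
  \<comment> \<open>Expectations under \<open>P\<close> are Lebesgue integrals weighted by the
    Gaussian density. Nonnegativity of \<open>p\<close> keeps the passage through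
    \<open>ennreal\<close> faithful.\<close>
  have P: "has_bochner_integral P f v"
    if "f \<in> borel_measurable borel" "has_bochner_integral lborel (\<lambda>x. mvn_density \<mu> S x *\<^sub>R f x) v"
    for f :: "real ^ 'd \<Rightarrow> 'b::{banach, second_countable_topology}" and v
    unfolding P_def using that p_nonneg by (intro has_bochner_integral_density) (auto simp: p[symmetric])
  have "prob_space P"
    using p_int p_nonneg
    by (intro prob_spaceI) (simp add: P_def emeasure_density nn_integral_eq_integral has_bochner_integral_iff)
  moreover have "has_bochner_integral P (\<lambda>x. x) \<mu>"
    using has_bochner_integral_mvn_density_mean[OF spdS] by (intro P) auto
  moreover have "has_bochner_integral P (\<lambda>x. (x - \<mu>) $ i * (x - \<mu>) $ j) (S $ i $ j)" for i j
    using has_bochner_integral_mvn_density_covariance[OF spdS] by (intro P) auto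
  moreover have "S = (mat 1 - K ** H) ** \<Sigma>bar ** matrix_inv (\<Sigma>bar + \<Sigma>O) ** \<Sigma>O"
  proof -
    \<comment> \<open>Splitting the identity \<open>S ** L = mat 1\<close> along the summands of
      \<open>L\<close> isolates K H and expresses I - K H through the two remaining
      precisions.\<close>
    have "S ** L = K ** H + S ** (matrix_inv \<Sigma>O + matrix_inv \<Sigma>bar)"
      by (simp add: L_def K_def matrix_add_ldistrib matrix_mul_assoc)
    then have "mat 1 - K ** H = S ** (matrix_inv \<Sigma>O + matrix_inv \<Sigma>bar)"
      by (simp add: LS)
    then have "(mat 1 - K ** H) ** \<Sigma>bar ** matrix_inv (\<Sigma>bar + \<Sigma>O) ** \<Sigma>O =
        S ** ((matrix_inv \<Sigma>O + matrix_inv \<Sigma>bar) ** (\<Sigma>bar ** matrix_inv (\<Sigma>bar + \<Sigma>O) ** \<Sigma>O))"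
      by (simp only: matrix_mul_assoc)
    then show ?thesis
      by (simp add: parallel_sum_inverse[OF assms(1,2)])
  qed
  ultimately show ?thesis
    using intJ \<open>C > 0\<close> spdS Sinv p
    unfolding Let_def J_def[symmetric] p_def[symmetric] P_def[symmetric] L_def[symmetric]
      S_def[symmetric] K_def[symmetric] \<mu>_def[symmetric]
    by blast
qed

end
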